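(* Let $d\geq 1$. Every self-similar set $E\subset\mathbb{R}^d$ that is not contained in a hyperplane of $\mathbb{R}^d$ is arithmetically thick.
   Context: A self-similar set in $\mathbb{R}^d$ is a non-empty compact set $E$ with $E=\bigcup_{i=1}^\ell \phi_i(E)$, where $\{\phi_i\}_{i=1}^\ell$ is a finite family of contracting similitudes of $\mathbb{R}^d$, i.e. maps $\phi_i:\mathbb{R}^d\to\mathbb{R}^d$ with $\|\phi_i(x)-\phi_i(y)\|=\rho_i\|x-y\|$ for all $x,y$, where $0<\rho_i<1$. A hyperplane is a $(d-1)$-dimensional affine subspace. A compact set $E\subset\mathbb{R}^d$ is arithmetically thick if there is a positive integer $n$ such that the $n$-fold sum $\oplus_nE=\{x_1+\cdots+x_n: x_i\in E,\ 1\le i\le n\}$ has non-empty interior. *)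

theory Defs
  imports "HOL-Analysis.Analysis"
begin

definition contracting_similitude :: "('a::euclidean_space \<Rightarrow> 'a) \<Rightarrow> bool" where
  "contracting_similitude f \<longleftrightarrow>
     (\<exists>\<rho>::real. 0 < \<rho> \<and> \<rho> < 1 \<and> (\<forall>x y. norm (f x - f y) = \<rho> * norm (x - y)))"

text \<open>The index set may be empty here, but then so is the union, contradicting
  \<^term>\<open>E \<noteq> {}\<close>; no separate condition on the number of maps is needed.\<close>

definition self_similar_set :: "'a::euclidean_space set \<Rightarrow> bool" where
  "self_similar_set E \<longleftrightarrow>
     E \<noteq> {} \<and> compact E \<and>
     (\<exists>(l::nat) \<phi>. (\<forall>i\<in>{1..l}. contracting_similitude (\<phi> i)) \<and> E = (\<Union>i\<in>{1..l}. \<phi> i ` E))"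

text \<open>In dimension one the hyperplanes are exactly the singletons.\<close>

definition hyperplane :: "'a::euclidean_space set \<Rightarrow> bool" where
  "hyperplane H \<longleftrightarrow> affine H \<and> aff_dim H = int DIM('a) - 1"

definition nfold_sum :: "nat \<Rightarrow> 'a::euclidean_space set \<Rightarrow> 'a set" where
  "nfold_sum n E = {(\<Sum>i=1..n. x i) | x :: nat \<Rightarrow> 'a. \<forall>i\<in>{1..n}. x i \<in> E}"

definition arithmetically_thick :: "'a::euclidean_space set \<Rightarrow> bool" where
  "arithmetically_thick E \<longleftrightarrow> compact E \<and> (\<exists>n::nat. n \<ge> 1 \<and> interior (nfold_sum n E) \<noteq> {})"

end

theory Submission
  imports Defs
begin

text \<open>Fix \<open>p\<close> in the interior of the convex hull of \<open>E\<close> and a target \<open>z\<close> near \<open>n p\<close>. Approximate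
  \<open>z\<close> by sums \<open>g\<^sub>1 p + \<dots> + g\<^sub>n p\<close>, where the \<open>g\<^sub>i\<close> are similitudes of ratio \<open>r\<^sub>i\<close> mapping \<open>E\<close> into
  itself, starting from the identities. Repeatedly replace a \<open>g\<^sub>i\<close> of largest ratio by \<open>g\<^sub>i \<circ> h\<close>, where
  \<open>h\<close> ranges over compositions of a fixed number of maps of the system; since \<open>p\<close> is interior to the
  hull, \<open>h\<close> can be chosen so that the reference point moves in the direction of the current error by
  at least a fixed multiple \<open>c r\<^sub>i\<close>. The ratios stay comparable, so for large \<open>n\<close> the error stays at
  most \<open>(c / 2) (r\<^sub>1 + \<dots> + r\<^sub>n)\<close>, which tends to \<open>0\<close>. As the \<open>n\<close>-fold sum is compact, it
  contains a ball around \<open>n p\<close>.\<close>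

section \<open>Similitudes and small cells of a self-similar set\<close>

definition similitude :: "real \<Rightarrow> ('a::euclidean_space \<Rightarrow> 'a) \<Rightarrow> bool" where
  "similitude q f \<longleftrightarrow> 0 < q \<and> (\<forall>x y. norm (f x - f y) = q * norm (x - y))"

lemma similitude_id: "similitude 1 (\<lambda>x. x)"
  by (simp add: similitude_def)

lemma similitude_comp: "similitude q f \<Longrightarrow> similitude r g \<Longrightarrow> similitude (q * r) (f \<circ> g)"
  by (simp add: similitude_def)

text \<open>Rescaled and translated to fix the origin, \<open>f\<close> is an isometry, hence
  orthogonal; \<open>e'\<close> is the preimage of \<open>e\<close> under that orthogonal
  map.\<close>

lemma similitude_inner:
  fixes f :: "'a::euclidean_space \<Rightarrow> 'a"
  assumes "similitude q f"
  obtains e' where "norm e' = norm e" "\<And>x y. e \<bullet> (f x - f y) = q * (e' \<bullet> (x - y))"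
proof -
  define T where "T x = (1 / q) *\<^sub>R (f x - f 0)" for x
  have q: "q > 0" and n: "\<And>x y. norm (f x - f y) = q * norm (x - y)"
    using assms by (auto simp: similitude_def)
  have diff: "T x - T y = (1 / q) *\<^sub>R (f x - f y)" for x y
    by (simp add: T_def flip: scaleR_diff_right)
  have "dist (T x) (T y) = dist x y" for x y
    using q by (simp add: dist_norm diff n)
  then have T: "orthogonal_transformation T"
    unfolding orthogonal_transformation_isometry by (simp add: T_def)
  then obtain e' where e': "e = T e'"
    using orthogonal_transformation_surj by (metis surjD)
  have lin: "linear T"
    using T by (simp add: orthogonal_transformation_def)
  have "e \<bullet> (f x - f y) = q * (e' \<bullet> (x - y))" for x y
  proof -
    have "f x - f y = q *\<^sub>R T (x - y)"
      using q by (simp add: linear_diff[OF lin] diff)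
    then show ?thesis
      using T by (simp add: e' orthogonal_transformation_def)
  qed
  moreover have "norm e' = norm e"
    using T by (simp add: e' orthogonal_transformation)
  ultimately show thesis
    using that by blast
qed

text \<open>Iterating the self-similarity equation puts each point of \<open>E\<close> in a cell of
  every level \<open>m\<close>, whose ratio is a product of \<open>m\<close> factors between the
  least ratio \<open>a\<close> and the greatest ratio \<open>b\<close>. The upper bound makes cells
  small, the lower one keeps ratios comparable.\<close>

lemma self_similar_deep_cell:
  fixes E :: "'a::euclidean_space set"
  assumes "self_similar_set E"
  obtains a b :: real where "0 < a" "a \<le> b" "b < 1"
    "\<And>m v. v \<in> E \<Longrightarrow>
      \<exists>q h. similitude q h \<and> h ` E \<subseteq> E \<and> v \<in> h ` E \<and> a ^ m \<le> q \<and> q \<le> b ^ m"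
proof -
  obtain l :: nat and \<phi> where ne: "E \<noteq> {}"
    and \<phi>: "\<forall>i\<in>{1..l}. contracting_similitude (\<phi> i)" and E: "E = (\<Union>i\<in>{1..l}. \<phi> i ` E)"
    using assms by (auto simp: self_similar_set_def)
  obtain \<rho> where \<rho>: "\<And>i. i \<in> {1..l} \<Longrightarrow> \<rho> i < 1 \<and> similitude (\<rho> i) (\<phi> i)"
    using \<phi> unfolding contracting_similitude_def similitude_def by metis
  have l: "{1..l} \<noteq> {}"
    using ne E by blast
  define a b where "a = Min (\<rho> ` {1..l})" and "b = Max (\<rho> ` {1..l})"
  have ab: "a \<le> \<rho> i \<and> \<rho> i \<le> b" if "i \<in> {1..l}" for i
    using that by (auto simp: a_def b_def)
  have a: "0 < a"
    unfolding a_def using l \<rho> by (subst Min_gr_iff) (auto simp: similitude_def)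
  have b: "b < 1"
    unfolding b_def using l \<rho> by (subst Max_less_iff) auto
  have "a \<le> b"
    using l ab by fastforce
  moreover have "\<exists>q h. similitude q h \<and> h ` E \<subseteq> E \<and> v \<in> h ` E \<and> a ^ m \<le> q \<and> q \<le> b ^ m"
    if "v \<in> E" for m v
    using that
  proof (induction m arbitrary: v)
    case 0
    then show ?case
      using similitude_id by (intro exI[of _ 1] exI[of _ "\<lambda>x. x"]) auto
  next
    case (Suc m)
    then obtain i w where i: "i \<in> {1..l}" and w: "w \<in> E" "v = \<phi> i w"
      using E by blast
    obtain q h where h: "similitude q h" "h ` E \<subseteq> E" "w \<in> h ` E" "a ^ m \<le> q" "q \<le> b ^ m"
      using Suc.IH[OF w(1)] by blast
    have "\<phi> i ` E \<subseteq> E"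
      using i E by blast
    moreover have "a ^ Suc m \<le> \<rho> i * q" "\<rho> i * q \<le> b ^ Suc m"
      using ab[OF i] a h by (auto intro!: mult_mono simp: similitude_def)
    ultimately show ?case
      using similitude_comp[of "\<rho> i" "\<phi> i" q h] \<rho>[OF i] h w
      by (intro exI[of _ "\<rho> i * q"] exI[of _ "\<phi> i \<circ> h"]) (auto simp: o_def)
  qed
  ultimately show thesis
    using that a b by blast
qed

section \<open>Moving the reference point in a prescribed direction\<close>

text \<open>Otherwise an open half-space contains \<open>E\<close>, hence its hull, but misses the
  point \<open>p + c *\<^sub>R sgn e\<close> of the ball. Since \<open>sgn 0 = 0\<close>, this
  covers \<open>e = 0\<close> as well.\<close>

lemma convex_hull_support:
  fixes E :: "'a::euclidean_space set"
  assumes "cball p c \<subseteq> convex hull E" "0 \<le> c"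
  shows "\<exists>v\<in>E. c * norm e \<le> e \<bullet> (v - p)"
proof (rule ccontr)
  assume "\<not> ?thesis"
  then have "E \<subseteq> {x. e \<bullet> x < c * norm e + e \<bullet> p}"
    by (force simp: inner_diff_right)
  then have "convex hull E \<subseteq> {x. e \<bullet> x < c * norm e + e \<bullet> p}"
    by (intro hull_minimal convex_halfspace_lt)
  moreover have "p + c *\<^sub>R sgn e \<in> cball p c"
    using assms(2) by (simp add: dist_norm norm_sgn)
  ultimately have "e \<bullet> (p + c *\<^sub>R sgn e) < c * norm e + e \<bullet> p"
    using assms(1) by blast
  moreover have "e \<bullet> sgn e = norm e"
    by (cases "e = 0") (simp_all add: sgn_div_norm dot_square_norm power2_eq_square)
  ultimately show False
    by (simp add: inner_add_right)
qed

text \<open>A convex set with empty interior lies in a hyperplane.\<close>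

lemma interior_convex_hull_nonempty:
  fixes E :: "'a::euclidean_space set"
  assumes "\<not> (\<exists>H. hyperplane H \<and> E \<subseteq> H)"
  shows "interior (convex hull E) \<noteq> {}"
proof
  assume "interior (convex hull E) = {}"
  then obtain a b where "a \<noteq> 0" "convex hull E \<subseteq> {x. a \<bullet> x = b}"
    using empty_interior_subset_hyperplane convex_convex_hull by metis
  moreover from this have "hyperplane {x. a \<bullet> x = b}"
    by (simp add: hyperplane_def affine_hyperplane)
  ultimately show False
    using assms hull_subset[of E convex] by blast
qed

text \<open>The direction \<open>e\<close> is pulled back through \<open>g\<close>, a point
  \<open>v\<close> of \<open>E\<close> far out in that direction is chosen, and \<open>g\<close> is
  composed with the map \<open>h\<close> of a cell containing \<open>v\<close>. The cell is so deep
  that \<open>h p\<close> keeps half of the gain guaranteed at \<open>v\<close>, even if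
  \<open>p\<close> lies outside \<open>E\<close>.\<close>

lemma steering:
  fixes E :: "'a::euclidean_space set"
  assumes E: "self_similar_set E" and p: "p \<in> interior (convex hull E)"
  obtains c D \<mu> \<kappa> :: real where "0 < c" "c \<le> D" "0 < \<mu>" "\<mu> \<le> \<kappa>" "\<kappa> < 1"
    "\<And>r g e. similitude r g \<Longrightarrow> g ` E \<subseteq> E \<Longrightarrow>
      \<exists>r' g'. similitude r' g' \<and> g' ` E \<subseteq> E \<and> \<mu> * r \<le> r' \<and> r' \<le> \<kappa> * r \<and>
        norm (g' p - g p) \<le> D * r \<and> c * r * norm e \<le> e \<bullet> (g' p - g p)"
proof -
  obtain a b :: real where ab: "0 < a" "a \<le> b" "b < 1"
    and cell: "\<And>m v. v \<in> E \<Longrightarrow>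
      \<exists>q h. similitude q h \<and> h ` E \<subseteq> E \<and> v \<in> h ` E \<and> a ^ m \<le> q \<and> q \<le> b ^ m"
    using self_similar_deep_cell[OF E] by blast
  obtain d where d: "0 < d" "cball p d \<subseteq> convex hull E"
    using p by (meson mem_interior_cball)
  \<comment> \<open>Half of the gain \<open>d\<close> is given up for the distance from
    \<open>h p\<close> to \<open>v\<close>.\<close>
  define c where "c = d / 2"
  have c: "0 < c"
    using d by (simp add: c_def)
  have "bounded E"
    using E by (simp add: self_similar_set_def compact_imp_bounded)
  then obtain R where R: "0 < R" "E \<subseteq> ball p R"
    by (meson bounded_subset_ballD)
  \<comment> \<open>The bound \<open>c / R\<close> will keep \<open>h p\<close> within
    \<open>c\<close> of \<open>v\<close>; the bound \<open>1\<close> makes \<open>b ^ m\<close> a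
    valid contraction factor \<open>\<kappa>\<close>.\<close>
  obtain m where m: "b ^ m < min 1 (c / R)"
    using real_arch_pow_inv[of "min 1 (c / R)" b] ab c R by auto
  have "\<exists>r' g'. similitude r' g' \<and> g' ` E \<subseteq> E \<and> a ^ m * r \<le> r' \<and> r' \<le> b ^ m * r \<and>
        norm (g' p - g p) \<le> (R + c) * r \<and> c * r * norm e \<le> e \<bullet> (g' p - g p)"
    if g: "similitude r g" "g ` E \<subseteq> E" for r g e
  proof -
    have r: "0 < r"
      using g by (simp add: similitude_def)
    obtain e' where e': "norm e' = norm e" "\<And>x y. e \<bullet> (g x - g y) = r * (e' \<bullet> (x - y))"
      using similitude_inner[OF g(1)] by metis
    obtain v where v: "v \<in> E" "d * norm e' \<le> e' \<bullet> (v - p)"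
      using convex_hull_support[OF d(2)] d(1) by auto
    obtain q h x where h: "similitude q h" "h ` E \<subseteq> E" "x \<in> E" "v = h x" "a ^ m \<le> q" "q \<le> b ^ m"
      using cell[OF v(1), of m] by blast
    have "norm (h p - v) = q * norm (p - x)"
      using h by (simp add: similitude_def)
    also have "\<dots> \<le> (c / R) * R"
      using h m R c by (intro mult_mono) (auto simp: dist_norm)
    finally have hp: "norm (h p - v) \<le> c"
      using R by simp
    have "norm (v - p) \<le> R"
      using R v(1) by (auto simp: dist_norm norm_minus_commute)
    then have "norm (h p - p) \<le> R + c"
      using hp norm_triangle_ineq[of "h p - v" "v - p"] by simp
    then have 1: "norm (g (h p) - g p) \<le> (R + c) * r"
      using g r by (simp add: similitude_def)
    have "\<bar>e' \<bullet> (h p - v)\<bar> \<le> norm e' * c"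
      using Cauchy_Schwarz_ineq2[of e' "h p - v"] hp
      by (meson mult_left_mono norm_ge_zero order_trans)
    moreover have "e' \<bullet> (h p - p) = e' \<bullet> (h p - v) + e' \<bullet> (v - p)"
      by (simp flip: inner_add_right)
    ultimately have "c * norm e \<le> e' \<bullet> (h p - p)"
      using v(2) unfolding c_def e'(1) by (auto simp: abs_le_iff mult.commute)
    then have 2: "c * r * norm e \<le> e \<bullet> (g (h p) - g p)"
      using r by (simp add: e'(2) mult_left_mono mult.assoc mult.left_commute[of c])
    show ?thesis
      using 1 2 similitude_comp[OF g(1) h(1)] g h r
      by (intro exI[of _ "r * q"] exI[of _ "g \<circ> h"]) (auto simp: mult.commute)
  qed
  moreover have "a ^ m \<le> b ^ m" "b ^ m < 1" "0 < a ^ m"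
    using ab m by (auto intro: power_mono)
  ultimately show thesis
    using c R by (intro that[of c "R + c" "a ^ m" "b ^ m"]) auto
qed

text \<open>\<open>M\<close> is the ratio being replaced, \<open>S\<close> and \<open>S'\<close> are
  the sums of ratios before and after. A large error shrinks by at least \<open>c * M / 2\<close>,
  because the inner product outweighs the square of \<open>y\<close>, while its permitted bound
  drops by no more than that. A small error is handled by the triangle inequality and the size of
  \<open>S'\<close>.\<close>

lemma error_step:
  fixes e y :: "'a::euclidean_space"
  assumes c: "0 < c" "c \<le> D" and M: "0 < M"
    and y: "norm y \<le> D * M" "c * M * norm e \<le> e \<bullet> y"
    and e: "norm e \<le> c / 2 * S" and S': "S - M \<le> S'"
    and large: "(D\<^sup>2 / c + D) * M \<le> c / 2 * S'"
  shows "norm (e - y) \<le> c / 2 * S'"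
\<comment> \<open>Beyond this threshold \<open>(D * M)\<^sup>2 \<le> c * M * norm e\<close>.\<close>
proof (cases "D\<^sup>2 / c * M \<le> norm e")
  case True
  then have D: "D\<^sup>2 * M \<le> c * norm e"
    using c by (simp add: field_simps)
  have "c * c * M \<le> D\<^sup>2 * M"
    using c M by (simp add: power2_eq_square mult_mono)
  then have "c * M \<le> norm e"
    using D c by (smt (verit) mult.assoc mult_le_cancel_left_pos)
  have "(norm y)\<^sup>2 \<le> (D * M)\<^sup>2"
    using y(1) by (intro power_mono) auto
  also have "\<dots> = M * (D\<^sup>2 * M)"
    by (simp add: power2_eq_square)
  also have "\<dots> \<le> M * (c * norm e)"
    using D M by (intro mult_left_mono) auto
  finally have y2: "(norm y)\<^sup>2 \<le> c * M * norm e"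
    by (simp only: ac_simps)
  have "(norm (e - y))\<^sup>2 = (norm e)\<^sup>2 + (norm y)\<^sup>2 - 2 * (e \<bullet> y)"
    using dot_norm_neg[of e y] by simp
  also have "\<dots> \<le> (norm e)\<^sup>2 - c * M * norm e"
    using y(2) y2 by linarith
  also have "\<dots> \<le> (norm e)\<^sup>2 - c * M * norm e + (c * M / 2)\<^sup>2"
    by simp
  also have "\<dots> = (norm e - c * M / 2)\<^sup>2"
    by (simp add: power2_diff)
  finally have sq: "(norm (e - y))\<^sup>2 \<le> (norm e - c * M / 2)\<^sup>2" .
  have "0 < c * M"
    using c M by simp
  then have "0 \<le> norm e - c * M / 2"
    using \<open>c * M \<le> norm e\<close> by linarith
  with sq have "norm (e - y) \<le> norm e - c * M / 2"
    by (rule power2_le_imp_le)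
  also have "\<dots> \<le> c / 2 * (S - M)"
    using e by (simp add: algebra_simps)
  also have "\<dots> \<le> c / 2 * S'"
    using c S' by simp
  finally show ?thesis .
next
  case False
  then show ?thesis
    using norm_triangle_ineq4[of e y] y(1) large unfolding distrib_right by linarith
qed

section \<open>Compactness of the n-fold sum\<close>

lemma nfold_sum_Suc: "nfold_sum (Suc n) E = {x + y | x y. x \<in> nfold_sum n E \<and> y \<in> E}"
proof (intro equalityI subsetI)
  fix z assume "z \<in> {x + y | x y. x \<in> nfold_sum n E \<and> y \<in> E}"
  then obtain x y where z: "z = (\<Sum>i=1..n. x i) + y" "\<forall>i\<in>{1..n}. x i \<in> E" "y \<in> E"
    by (auto simp: nfold_sum_def)
  then have "z = (\<Sum>i=1..Suc n. (x(Suc n := y)) i)" "\<forall>i\<in>{1..Suc n}. (x(Suc n := y)) i \<in> E"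
    by (auto simp: le_Suc_eq)
  then show "z \<in> nfold_sum (Suc n) E"
    unfolding nfold_sum_def by blast
qed (fastforce simp: nfold_sum_def)

lemma compact_nfold_sum: "compact E \<Longrightarrow> compact (nfold_sum n E)"
proof (induction n)
  case 0
  then show ?case by (simp add: nfold_sum_def)
next
  case (Suc n)
  then show ?case by (simp add: nfold_sum_Suc compact_sums)
qed

section \<open>Refining approximations by sums of images of \<open>p\<close>\<close>

text \<open>Measuring the error against the sum of the ratios forces it to zero along with that sum.
  Comparability makes each single ratio small against the sum when \<open>n\<close> is
  large.\<close>

definition balanced_approx ::
  "'a::euclidean_space set \<Rightarrow> 'a \<Rightarrow> real \<Rightarrow> real \<Rightarrow> nat \<Rightarrow> 'a \<Rightarrow> (nat \<Rightarrow> real) \<Rightarrow> (nat \<Rightarrow> 'a \<Rightarrow> 'a) \<Rightarrow> bool"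
  where
  "balanced_approx E p K \<mu> n z r g \<longleftrightarrow>
     (\<forall>i\<in>{1..n}. similitude (r i) (g i) \<and> g i ` E \<subseteq> E) \<and>
     (\<forall>i\<in>{1..n}. \<forall>j\<in>{1..n}. \<mu> * r i \<le> r j) \<and>
     norm (z - (\<Sum>i=1..n. g i p)) \<le> K * (\<Sum>i=1..n. r i)"

text \<open>Replacing the largest ratio keeps the ratios comparable, since the new one is at least
  \<open>\<mu>\<close> times the old maximum. Being at least the average, the largest ratio takes a
  fixed share off the sum.\<close>

lemma balanced_approx_refine:
  fixes E :: "'a::euclidean_space set"
  assumes c: "0 < c" "c \<le> D" and \<mu>: "0 < \<mu>" "\<kappa> < 1" and n: "0 < n"
    and large: "D\<^sup>2 / c + D \<le> c / 2 * (real n * \<mu>)"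
    and steer: "\<And>r g e. similitude r g \<Longrightarrow> g ` E \<subseteq> E \<Longrightarrow>
      \<exists>r' g'. similitude r' g' \<and> g' ` E \<subseteq> E \<and> \<mu> * r \<le> r' \<and> r' \<le> \<kappa> * r \<and>
        norm (g' p - g p) \<le> D * r \<and> c * r * norm e \<le> e \<bullet> (g' p - g p)"
    and approx: "balanced_approx E p (c / 2) \<mu> n z r g"
  shows "\<exists>r' g'. balanced_approx E p (c / 2) \<mu> n z r' g' \<and>
    (\<Sum>i=1..n. r' i) \<le> (1 - (1 - \<kappa>) / n) * (\<Sum>i=1..n. r i)"
proof -
  have g: "\<And>i. i \<in> {1..n} \<Longrightarrow> similitude (r i) (g i) \<and> g i ` E \<subseteq> E"
    and bal: "\<And>i j. i \<in> {1..n} \<Longrightarrow> j \<in> {1..n} \<Longrightarrow> \<mu> * r i \<le> r j"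
    and err: "norm (z - (\<Sum>i=1..n. g i p)) \<le> c / 2 * (\<Sum>i=1..n. r i)"
    using approx unfolding balanced_approx_def by blast+
  have "Max (r ` {1..n}) \<in> r ` {1..n}"
    using n by (intro Max_in) auto
  then obtain k where k: "k \<in> {1..n}" and "r k = Max (r ` {1..n})"
    by auto
  then have max: "r i \<le> r k" if "i \<in> {1..n}" for i
    using that by simp
  define e where "e = z - (\<Sum>i=1..n. g i p)"
  obtain s h where s: "similitude s h" "h ` E \<subseteq> E" "\<mu> * r k \<le> s" "s \<le> \<kappa> * r k"
    "norm (h p - g k p) \<le> D * r k" "c * r k * norm e \<le> e \<bullet> (h p - g k p)"
    using steer[of "r k" "g k" e] g[OF k] by blast
  define r' g' where "r' = r(k := s)" and "g' = g(k := h)"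
  have rk: "0 < r k"
    using g[OF k] by (simp add: similitude_def)
  \<comment> \<open>A general \<open>f\<close> serves both the ratios and the values at
    \<open>p\<close>.\<close>
  have upd: "(\<Sum>i=1..n. f (if i = k then a else b i)) = (\<Sum>i=1..n. f (b i)) + (f a - f (b k))"
    for f :: "'c \<Rightarrow> 'd::real_vector" and a b
  proof -
    have "(\<Sum>i=1..n. f (if i = k then a else b i)) =
        (\<Sum>i=1..n. f (b i) + (if i = k then f a - f (b k) else 0))"
      by (intro sum.cong) auto
    then show ?thesis
      using k by (simp add: sum.distrib)
  qed
  have sum_r': "(\<Sum>i=1..n. r' i) = (\<Sum>i=1..n. r i) + (s - r k)"
    using upd[of "\<lambda>x. x" s r] by (simp add: r'_def fun_upd_def)
  have sum_g': "(\<Sum>i=1..n. g' i p) = (\<Sum>i=1..n. g i p) + (h p - g k p)"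
    using upd[of "\<lambda>f. f p" h g] by (simp add: g'_def fun_upd_def)
  have "s \<le> r k"
    using s(4) rk \<mu>(2) by (smt (verit) mult_less_cancel_right1)
  have bal': "\<mu> * r' i \<le> r' j" if "i \<in> {1..n}" "j \<in> {1..n}" for i j
  proof -
    have "r' i \<le> r k"
      using max[OF that(1)] \<open>s \<le> r k\<close> by (simp add: r'_def)
    then have "\<mu> * r' i \<le> \<mu> * r k"
      using \<mu> by simp
    also have "\<dots> \<le> r' j"
      using s(3) bal[OF k that(2)] by (simp add: r'_def)
    finally show ?thesis .
  qed
  \<comment> \<open>All \<open>n\<close> new ratios are at least \<open>\<mu> * r k\<close>, so
    \<open>large\<close> makes their sum big enough for the small-error case.\<close>
  have "real n * (\<mu> * r k) \<le> (\<Sum>i=1..n. r' i)"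
    using sum_bounded_below[of "{1..n}" "\<mu> * r k" r'] s(3) bal[OF k] by (simp add: r'_def)
  then have "c / 2 * (real n * \<mu>) * r k \<le> c / 2 * (\<Sum>i=1..n. r' i)"
    using c by (simp add: mult.assoc)
  moreover have "(D\<^sup>2 / c + D) * r k \<le> c / 2 * (real n * \<mu>) * r k"
    using large rk by (intro mult_right_mono) auto
  moreover have "0 < s"
    using s(1) by (simp add: similitude_def)
  ultimately have "norm (e - (h p - g k p)) \<le> c / 2 * (\<Sum>i=1..n. r' i)"
    using err[folded e_def] s(5,6) c rk sum_r'
    by (intro error_step[of c D "r k" _ e "\<Sum>i=1..n. r i"]) linarith+
  then have "norm (z - (\<Sum>i=1..n. g' i p)) \<le> c / 2 * (\<Sum>i=1..n. r' i)"
    by (simp only: sum_g' e_def diff_diff_eq)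
  then have "balanced_approx E p (c / 2) \<mu> n z r' g'"
    using bal' g s(1,2) unfolding balanced_approx_def by (simp add: r'_def g'_def)
  moreover have "(\<Sum>i=1..n. r' i) \<le> (1 - (1 - \<kappa>) / n) * (\<Sum>i=1..n. r i)"
  proof -
    have "(\<Sum>i=1..n. r i) \<le> n * r k"
      using sum_bounded_above[of "{1..n}" r "r k"] max by simp
    then have "(1 - \<kappa>) / n * (\<Sum>i=1..n. r i) \<le> (1 - \<kappa>) / n * (n * r k)"
      using \<mu> n by (intro mult_left_mono) auto
    also have "\<dots> = r k - \<kappa> * r k"
      using n by (simp add: field_simps)
    finally show ?thesis
      using s(4) left_diff_distrib[of 1 "(1 - \<kappa>) / n" "\<Sum>i=1..n. r i"]
      unfolding sum_r' mult_1_left by linarith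
  qed
  ultimately show ?thesis by blast
qed

section \<open>A ball around \<open>n *\<^sub>R p\<close> inside the n-fold sum\<close>

theorem corollary1p3:
  fixes E :: "'a::euclidean_space set"
  assumes "self_similar_set E"
    and "\<not> (\<exists>H. hyperplane H \<and> E \<subseteq> H)"
  shows "arithmetically_thick E"
proof -
  have E: "compact E" "E \<noteq> {}"
    using assms(1) by (auto simp: self_similar_set_def)
  then obtain x where x: "x \<in> E" by blast
  obtain p where "p \<in> interior (convex hull E)"
    using interior_convex_hull_nonempty[OF assms(2)] by blast
  then obtain c D \<mu> \<kappa> :: real where c: "0 < c" "c \<le> D" and \<mu>: "0 < \<mu>" "\<mu> \<le> \<kappa>" "\<kappa> < 1"
    and steer: "\<And>r g e. similitude r g \<Longrightarrow> g ` E \<subseteq> E \<Longrightarrow>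
      \<exists>r' g'. similitude r' g' \<and> g' ` E \<subseteq> E \<and> \<mu> * r \<le> r' \<and> r' \<le> \<kappa> * r \<and>
        norm (g' p - g p) \<le> D * r \<and> c * r * norm e \<le> e \<bullet> (g' p - g p)"
    using steering[OF assms(1)] by metis
  obtain n :: nat where "(D\<^sup>2 / c + D) / (c / 2 * \<mu>) < n"
    using reals_Archimedean2 by blast
  then have large: "D\<^sup>2 / c + D \<le> c / 2 * (real n * \<mu>)"
    using c \<mu> by (simp add: divide_less_eq mult_ac)
  have "0 < D\<^sup>2 / c + D"
    using c by (intro add_pos_pos divide_pos_pos zero_less_power) auto
  then have n: "0 < n"
    using large by (cases n) auto
  define \<theta> where "\<theta> = 1 - (1 - \<kappa>) / n"
  have \<theta>: "0 \<le> \<theta>" "\<theta> < 1"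
    using \<mu> n by (auto simp: \<theta>_def divide_simps)
  \<comment> \<open>For identity maps the ratios sum to \<open>n\<close>, so this radius is exactly
    the error allowed at the start.\<close>
  have "z \<in> nfold_sum n E" if z: "norm (z - n *\<^sub>R p) \<le> c / 2 * n" for z
  proof -
    have decay: "\<exists>r g. balanced_approx E p (c / 2) \<mu> n z r g \<and> (\<Sum>i=1..n. r i) \<le> \<theta> ^ m * n" for m
    proof (induction m)
      case 0
      have "balanced_approx E p (c / 2) \<mu> n z (\<lambda>_. 1) (\<lambda>_ x. x)"
        using z \<mu> similitude_id by (auto simp: balanced_approx_def sum_constant_scaleR)
      then show ?case by force
    next
      case (Suc m)
      then obtain r g where rg: "balanced_approx E p (c / 2) \<mu> n z r g" "(\<Sum>i=1..n. r i) \<le> \<theta> ^ m * n"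
        by blast
      have "\<exists>r' g'. balanced_approx E p (c / 2) \<mu> n z r' g' \<and>
          (\<Sum>i=1..n. r' i) \<le> \<theta> * (\<Sum>i=1..n. r i)"
        unfolding \<theta>_def
        by (rule balanced_approx_refine[OF c \<mu>(1,3) n large _ rg(1)]) (rule steer)
      moreover have "\<theta> * (\<Sum>i=1..n. r i) \<le> \<theta> ^ Suc m * n"
        using mult_left_mono[OF rg(2) \<theta>(1)] by (simp add: mult.assoc)
      ultimately show ?case
        using order_trans by blast
    qed
    \<comment> \<open>\<open>c / 2\<close> accounts for the error of the approximation,
      \<open>norm (p - x)\<close> for replacing \<open>p\<close>, possibly outside \<open>E\<close>,
      by the point \<open>x\<close> of \<open>E\<close>.\<close>
    define C where "C = c / 2 + norm (p - x)"
    have near: "\<exists>y\<in>nfold_sum n E. dist y z \<le> C * (\<theta> ^ m * n)" for m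
    proof -
      obtain r g where rg: "balanced_approx E p (c / 2) \<mu> n z r g" "(\<Sum>i=1..n. r i) \<le> \<theta> ^ m * n"
        using decay by blast
      have g: "\<And>i. i \<in> {1..n} \<Longrightarrow> similitude (r i) (g i) \<and> g i ` E \<subseteq> E"
        and err: "norm (z - (\<Sum>i=1..n. g i p)) \<le> c / 2 * (\<Sum>i=1..n. r i)"
        using rg(1) unfolding balanced_approx_def by blast+
      have "norm ((\<Sum>i=1..n. g i p) - (\<Sum>i=1..n. g i x)) \<le> (\<Sum>i=1..n. norm (g i p - g i x))"
        by (simp add: norm_sum flip: sum_subtractf)
      also have "\<dots> = norm (p - x) * (\<Sum>i=1..n. r i)"
        using g by (simp add: similitude_def sum_distrib_left mult.commute)
      finally have "dist (\<Sum>i=1..n. g i x) z \<le> C * (\<Sum>i=1..n. r i)"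
        using err norm_triangle_ineq[of "z - (\<Sum>i=1..n. g i p)" "(\<Sum>i=1..n. g i p) - (\<Sum>i=1..n. g i x)"]
        by (simp add: C_def dist_norm norm_minus_commute distrib_right)
      also have "\<dots> \<le> C * (\<theta> ^ m * n)"
        using rg(2) c by (intro mult_left_mono) (auto simp: C_def)
      finally have "dist (\<Sum>i=1..n. g i x) z \<le> C * (\<theta> ^ m * n)" .
      moreover have "(\<Sum>i=1..n. g i x) \<in> nfold_sum n E"
        unfolding nfold_sum_def mem_Collect_eq
        using g x by (intro exI[of _ "\<lambda>i. g i x"]) blast
      ultimately show ?thesis by blast
    qed
    have "(\<lambda>m. C * (\<theta> ^ m * n)) \<longlonglongrightarrow> 0"
      using \<theta> by (intro tendsto_mult_right_zero tendsto_mult_left_zero LIMSEQ_power_zero) auto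
    then have "\<exists>m. C * (\<theta> ^ m * n) < \<epsilon>" if "0 < \<epsilon>" for \<epsilon>
      using order_tendstoD(2)[of _ 0 sequentially \<epsilon>] that
      by (fastforce simp: eventually_sequentially)
    \<comment> \<open>The approximation alone only reaches the closure; compactness turns this into
      membership.\<close>
    then have "z \<in> closure (nfold_sum n E)"
      unfolding closure_approachable using near by (meson order_le_less_trans)
    then show ?thesis
      using compact_nfold_sum[OF E(1)] by (simp add: compact_imp_closed)
  qed
  then have "ball (n *\<^sub>R p) (c / 2 * n) \<subseteq> nfold_sum n E"
    by (auto simp: dist_norm norm_minus_commute)
  moreover have "n *\<^sub>R p \<in> ball (n *\<^sub>R p) (c / 2 * n)"
    using c n by simp
  ultimately have "n *\<^sub>R p \<in> interior (nfold_sum n E)"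
    by (meson interior_maximal open_ball subsetD)
  then show ?thesis
    using E(1) n unfolding arithmetically_thick_def by (intro conjI exI[of _ n]) auto
qed

end
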